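(* The mechanism STEM is weakly budget balanced: for every profile of reports, in every time slot and every cluster, the sum of all monetary transfers to the agents is less than or equal to zero, i.e. the total of the payments made to the winning task executers is at most the total of the payments made by the winning task requesters.
   Context: Setting. There are $m$ task requesters (buyers) $\mathcal{B}_1,\dots,\mathcal{B}_m$ and $n$ task executers (sellers) $\mathcal{S}_1,\dots,\mathcal{S}_n$, $m\ll n$, and one common task; both kinds are called agents. The time horizon is a finite sequence of time slots $\tau_1,\dots,\tau_s$. Executer $\mathcal{S}_i$ reports a cost $\hat\upsilon_i^e$, arrival time $\hat a_i^e$ and departure time $\hat d_i^e$; requester $\mathcal{B}_i$ reports a value $\hat\upsilon_i^r$, arrival time $\hat a_i^r$ and departure time $\hat d_i^r$. The gap between arrival and departure of any agent is at most $\kappa$. Executers' locations (points of the plane) are observed by the platform. The mechanism STEM. In each slot $\tau$: (1) The participants are the agents left unmatched in earlier slots and the newly arrived agents. Among them, an agent is active if $\hat a\le \tau<\hat d$. Let $\mathcal{U}$ be the active executers and $\mathcal{R}$ the active requesters. (2) $\mathcal{U}$ is partitioned into $k$ clusters by $k$-means on locations: $k$ initial centroids are chosen at random, each executer is assigned to a nearest centroid, centroids are replaced by cluster means, and this is repeated until the clusters no longer change. (3) For each cluster separately a double auction is run between the executers of the cluster and $\mathcal{R}$ (the requesters are the same for all clusters). Sort the cluster's reported costs in ascending order $\gamma_1^e\le\gamma_2^e\le\cdots$ and the reported values of $\mathcal{R}$ in descending order $\gamma_1^r\ge\gamma_2^r\ge\cdots$. Let $\mathcal{I}^*=\operatorname{argmax}_i\{\gamma_i^r-\gamma_i^e<0\}$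 be the first losing index, i.e. the index with the largest value of $\gamma_i^r-\gamma_i^e$ among those where it is negative (slot prices are defined when such an index exists). Put $\Upsilon^e=\gamma^e_{\mathcal{I}^*}$, $\Upsilon^r=\gamma^r_{\mathcal{I}^*}$, $\eta=(\Upsilon^r+\Upsilon^e)/2$. The slot price for an executer $i$ of the cluster is $\mathcal{P}_i^e(\tau)=\eta$ if $\Upsilon^e\ge\eta$ and $\Upsilon^r\le\eta$, and $\mathcal{P}_i^e(\tau)=\Upsilon^e$ otherwise. The slot price for a requester $i$ is $\mathcal{P}_i^r(\tau)=\eta$ if $\Upsilon^e\le\eta$ and $\Upsilon^r\ge\eta$, and $\mathcal{P}_i^r(\tau)=\Upsilon^r$ otherwise. (4) Payments. For an executer $i$ of the cluster, $\chi_i^e=\min_{\rho\in[\hat d_i^e-\kappa,\tau]}\mathcal{P}_i^e(\rho)$ if he is freshly arrived ($\hat a_i^e=\tau$), where $\rho$ ranges over time slots; if he is still active from an earlier slot, $\chi_i^e$ is the minimum of his $\chi_i^e$ from the preceding slot and $\mathcal{P}_i^e(\tau)$. For a requester, $\chi_i^r=\max_{\rho\in[\hat d_i^r-\kappa,\tau]}\mathcal{P}_i^r(\rho)$ if freshly arrived, and the maximum of his preceding $\chi_i^r$ and $\mathcal{P}_i^r(\tau)$ if still active. An executer is retained if $\chi_i^e\ge\hat\upsilon_i^e$ and a requester is retained if $\chi_i^r\le\hat\upsilon_i^r$; the others are priced out of the market. (5) Allocation. Sort retained executers of the cluster by $\chi^e$ in ascending order and retained requesters by $\chi^r$ in descending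 order. Let $\mathcal{I}$ be the largest index $i$ with $\chi_i^r-\chi_i^e\ge0$ in these orders. For $l=1,\dots,\mathcal{I}$ the $l$-th executer is matched with the $l$-th requester; they win, the executer receives his $\chi^e$, the requester pays his $\chi^r$, and both leave that cluster's market. Retained but unmatched agents carry over to the next slot and neither pay nor receive anything. *)

theory Defs
  imports "HOL-Analysis.Analysis"
begin

text \<open>
  The time slots are \<open>1, \<dots>, s\<close>; arrival times, departure times and \<open>\<kappa>\<close> are measured in slots.
  Executers are \<open>0, \<dots>, n - 1\<close>, requesters \<open>0, \<dots>, m - 1\<close>, cluster labels \<open>0, \<dots>, k - 1\<close>.
\<close>

record market =
  nreq :: nat
  nexe :: nat
  nclus :: nat
  nslots :: nat
  kappa :: nat
  loc :: "nat \<Rightarrow> real ^ 2"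

record reports =
  cost :: "nat \<Rightarrow> real"
  arrE :: "nat \<Rightarrow> nat"
  depE :: "nat \<Rightarrow> nat"
  val :: "nat \<Rightarrow> real"
  arrR :: "nat \<Rightarrow> nat"
  depR :: "nat \<Rightarrow> nat"

definition admissible :: "market \<Rightarrow> reports \<Rightarrow> bool" where
  "admissible M \<theta> \<longleftrightarrow>
     (\<forall>i<nexe M. arrE \<theta> i \<le> depE \<theta> i \<and> depE \<theta> i - arrE \<theta> i \<le> kappa M) \<and>
     (\<forall>j<nreq M. arrR \<theta> j \<le> depR \<theta> j \<and> depR \<theta> j - arrR \<theta> j \<le> kappa M)"


section \<open>Clustering by k-means\<close>

definition nearest_assignment ::
    "nat \<Rightarrow> (nat \<Rightarrow> real ^ 2) \<Rightarrow> nat set \<Rightarrow> (nat \<Rightarrow> real ^ 2) \<Rightarrow> (nat \<Rightarrow> nat) \<Rightarrow> bool" where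
  "nearest_assignment k pos U \<mu> f \<longleftrightarrow>
     (\<forall>i\<in>U. is_arg_min (\<lambda>c. dist (pos i) (\<mu> c)) (\<lambda>c. c < k) (f i))"

text \<open>A label to which no point is assigned keeps its centroid.\<close>

definition cluster_means ::
    "(nat \<Rightarrow> real ^ 2) \<Rightarrow> nat set \<Rightarrow> (nat \<Rightarrow> nat) \<Rightarrow> (nat \<Rightarrow> real ^ 2) \<Rightarrow> nat \<Rightarrow> real ^ 2" where
  "cluster_means pos U f \<mu> c =
     (let C = {i \<in> U. f i = c}
      in if C = {} then \<mu> c else (\<Sum>i\<in>C. pos i) /\<^sub>R real (card C))"

text \<open>
  \<open>kmeans_iter k pos U \<mu> f g\<close>: iterating from centroids \<open>\<mu>\<close> with current assignment \<open>f\<close> may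
  stop with the assignment \<open>g\<close>. It is a relation because ties between nearest centroids may be
  broken in any way. Only the values of \<open>f\<close> and \<open>g\<close> on \<open>U\<close> matter.
\<close>

inductive kmeans_iter ::
    "nat \<Rightarrow> (nat \<Rightarrow> real ^ 2) \<Rightarrow> nat set \<Rightarrow> (nat \<Rightarrow> real ^ 2) \<Rightarrow> (nat \<Rightarrow> nat) \<Rightarrow> (nat \<Rightarrow> nat) \<Rightarrow> bool"
  for k :: nat and pos :: "nat \<Rightarrow> real ^ 2" and U :: "nat set" where
  stop: "nearest_assignment k pos U (cluster_means pos U f \<mu>) g \<Longrightarrow> \<forall>i\<in>U. g i = f i
           \<Longrightarrow> kmeans_iter k pos U \<mu> f g"
| step: "nearest_assignment k pos U (cluster_means pos U f \<mu>) f' \<Longrightarrow> \<exists>i\<in>U. f' i \<noteq> f i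
           \<Longrightarrow> kmeans_iter k pos U (cluster_means pos U f \<mu>) f' g
           \<Longrightarrow> kmeans_iter k pos U \<mu> f g"

text \<open>The outcomes of k-means over all choices of the random initial centroids.\<close>

definition kmeans_outcome ::
    "nat \<Rightarrow> (nat \<Rightarrow> real ^ 2) \<Rightarrow> nat set \<Rightarrow> (nat \<Rightarrow> nat) \<Rightarrow> bool" where
  "kmeans_outcome k pos U g \<longleftrightarrow>
     (\<exists>\<mu> f. nearest_assignment k pos U \<mu> f \<and> kmeans_iter k pos U \<mu> f g)"


section \<open>Slot prices of one double auction\<close>

definition ascending :: "(nat \<Rightarrow> real) \<Rightarrow> nat set \<Rightarrow> real list" where
  "ascending v A = sorted_list_of_multiset (image_mset v (mset_set A))"

definition descending :: "(nat \<Rightarrow> real) \<Rightarrow> nat set \<Rightarrow> real list" where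
  "descending v A = rev (ascending v A)"

text \<open>In what follows \<open>es\<close> are the sorted costs and \<open>rs\<close> the sorted values, indexed from 0.\<close>

definition losing_index :: "real list \<Rightarrow> real list \<Rightarrow> nat \<Rightarrow> bool" where
  "losing_index es rs = is_arg_max (\<lambda>i. rs ! i - es ! i)
     (\<lambda>i. i < length es \<and> i < length rs \<and> rs ! i - es ! i < 0)"

definition first_losing :: "real list \<Rightarrow> real list \<Rightarrow> nat" where
  "first_losing es rs = (LEAST i. losing_index es rs i)"

definition auction_price_exe :: "real list \<Rightarrow> real list \<Rightarrow> real option" where
  "auction_price_exe es rs =
     (if \<exists>i. losing_index es rs i
      then let ue = es ! first_losing es rs; ur = rs ! first_losing es rs; \<eta> = (ur + ue) / 2
           in Some (if ue \<ge> \<eta> \<and> ur \<le> \<eta> then \<eta> else ue)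
      else None)"

definition auction_price_req :: "real list \<Rightarrow> real list \<Rightarrow> real option" where
  "auction_price_req es rs =
     (if \<exists>i. losing_index es rs i
      then let ue = es ! first_losing es rs; ur = rs ! first_losing es rs; \<eta> = (ur + ue) / 2
           in Some (if ue \<le> \<eta> \<and> ur \<ge> \<eta> then \<eta> else ur)
      else None)"

text \<open>
  Optimum over the slots \<open>\<rho> \<in> [d - \<kappa>, \<tau>]\<close>, taken over those slots where the price is defined.
  Truncated subtraction is harmless here since slots start at 1.
\<close>

definition window_prices :: "nat \<Rightarrow> nat \<Rightarrow> nat \<Rightarrow> (nat \<Rightarrow> real option) \<Rightarrow> real set" where
  "window_prices d \<kappa> \<tau> P = {p. \<exists>\<rho>\<in>{1..\<tau>}. d - \<kappa> \<le> \<rho> \<and> P \<rho> = Some p}"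

definition window_min :: "nat \<Rightarrow> nat \<Rightarrow> nat \<Rightarrow> (nat \<Rightarrow> real option) \<Rightarrow> real option" where
  "window_min d \<kappa> \<tau> P =
     (if window_prices d \<kappa> \<tau> P = {} then None else Some (Min (window_prices d \<kappa> \<tau> P)))"

definition window_max :: "nat \<Rightarrow> nat \<Rightarrow> nat \<Rightarrow> (nat \<Rightarrow> real option) \<Rightarrow> real option" where
  "window_max d \<kappa> \<tau> P =
     (if window_prices d \<kappa> \<tau> P = {} then None else Some (Max (window_prices d \<kappa> \<tau> P)))"

fun merge_prices :: "(real \<Rightarrow> real \<Rightarrow> real) \<Rightarrow> real option \<Rightarrow> real option \<Rightarrow> real option" where
  "merge_prices f None q = q"
| "merge_prices f p None = p"
| "merge_prices f (Some p) (Some q) = Some (f p q)"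


section \<open>Executions of STEM\<close>

text \<open>
  An execution trace. The first argument is always the slot.
  \<^item> \<open>actE\<close>, \<open>actR\<close>: active executers and requesters.
  \<^item> \<open>label\<close>: cluster label of an executer. On active executers it is the k-means clustering. On
    all others it is unconstrained; it then only says which cluster's price a not yet arrived
    executer is shown for that slot (none, if the label denotes an empty cluster).
  \<^item> \<open>payE\<close>: the payment \<open>\<chi>\<^sup>e\<close> of an executer. \<open>payR\<close>: the payment \<open>\<chi>\<^sup>r\<close> of a requester, which
    depends on the cluster (second argument). It is \<open>None\<close> as long as no price has been defined.
  \<^item> \<open>ordE\<close>, \<open>ordR\<close>: the sorted lists of the allocation step, per slot and cluster.
\<close>

record trace =
  actE :: "nat \<Rightarrow> nat set"
  actR :: "nat \<Rightarrow> nat set"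
  label :: "nat \<Rightarrow> nat \<Rightarrow> nat"
  payE :: "nat \<Rightarrow> nat \<Rightarrow> real option"
  payR :: "nat \<Rightarrow> nat \<Rightarrow> nat \<Rightarrow> real option"
  ordE :: "nat \<Rightarrow> nat \<Rightarrow> nat list"
  ordR :: "nat \<Rightarrow> nat \<Rightarrow> nat list"

definition cluster :: "trace \<Rightarrow> nat \<Rightarrow> nat \<Rightarrow> nat set" where
  "cluster x \<tau> c = {i \<in> actE x \<tau>. label x \<tau> i = c}"

definition slot_price_exe :: "reports \<Rightarrow> trace \<Rightarrow> nat \<Rightarrow> nat \<Rightarrow> real option" where
  "slot_price_exe \<theta> x i \<tau> =
     auction_price_exe (ascending (cost \<theta>) (cluster x \<tau> (label x \<tau> i)))
                       (descending (val \<theta>) (actR x \<tau>))"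

definition slot_price_req :: "reports \<Rightarrow> trace \<Rightarrow> nat \<Rightarrow> nat \<Rightarrow> real option" where
  "slot_price_req \<theta> x c \<tau> =
     auction_price_req (ascending (cost \<theta>) (cluster x \<tau> c))
                       (descending (val \<theta>) (actR x \<tau>))"

definition retainedE :: "reports \<Rightarrow> trace \<Rightarrow> nat \<Rightarrow> nat \<Rightarrow> nat set" where
  "retainedE \<theta> x \<tau> c = {i \<in> cluster x \<tau> c. \<exists>p. payE x \<tau> i = Some p \<and> p \<ge> cost \<theta> i}"

definition retainedR :: "reports \<Rightarrow> trace \<Rightarrow> nat \<Rightarrow> nat \<Rightarrow> nat set" where
  "retainedR \<theta> x \<tau> c = {j \<in> actR x \<tau>. \<exists>p. payR x \<tau> c j = Some p \<and> p \<le> val \<theta> j}"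

definition priced_outE :: "reports \<Rightarrow> trace \<Rightarrow> nat \<Rightarrow> nat \<Rightarrow> bool" where
  "priced_outE \<theta> x \<tau> i \<longleftrightarrow> (\<exists>p. payE x \<tau> i = Some p \<and> p < cost \<theta> i)"

definition priced_outR :: "reports \<Rightarrow> trace \<Rightarrow> nat \<Rightarrow> nat \<Rightarrow> nat \<Rightarrow> bool" where
  "priced_outR \<theta> x \<tau> c j \<longleftrightarrow> (\<exists>p. payR x \<tau> c j = Some p \<and> p > val \<theta> j)"

text \<open>The index \<open>\<I>\<close>, counted from 1; it is 0 if no pair can trade.\<close>

definition trades :: "trace \<Rightarrow> nat \<Rightarrow> nat \<Rightarrow> nat" where
  "trades x \<tau> c = Max (insert 0 {l. 1 \<le> l \<and> l \<le> length (ordE x \<tau> c) \<and> l \<le> length (ordR x \<tau> c) \<and>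
     the (payR x \<tau> c (ordR x \<tau> c ! (l - 1))) - the (payE x \<tau> (ordE x \<tau> c ! (l - 1))) \<ge> 0})"

definition matching :: "trace \<Rightarrow> nat \<Rightarrow> nat \<Rightarrow> (nat \<times> nat) set" where
  "matching x \<tau> c = {(ordE x \<tau> c ! (l - 1), ordR x \<tau> c ! (l - 1)) | l. l \<in> {1..trades x \<tau> c}}"

definition winnersE :: "trace \<Rightarrow> nat \<Rightarrow> nat \<Rightarrow> nat set" where
  "winnersE x \<tau> c = fst ` matching x \<tau> c"

definition winnersR :: "trace \<Rightarrow> nat \<Rightarrow> nat \<Rightarrow> nat set" where
  "winnersR x \<tau> c = snd ` matching x \<tau> c"

text \<open>
  A requester takes part in the auctions of all clusters of a slot. He leaves the mechanism once
  he is matched in some cluster or priced out in every cluster.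
\<close>

definition carryE :: "market \<Rightarrow> reports \<Rightarrow> trace \<Rightarrow> nat \<Rightarrow> nat set" where
  "carryE M \<theta> x \<tau> = {i \<in> actE x \<tau>. \<not> priced_outE \<theta> x \<tau> i \<and> (\<forall>c<nclus M. i \<notin> winnersE x \<tau> c)}"

definition carryR :: "market \<Rightarrow> reports \<Rightarrow> trace \<Rightarrow> nat \<Rightarrow> nat set" where
  "carryR M \<theta> x \<tau> = {j \<in> actR x \<tau>. (\<exists>c<nclus M. \<not> priced_outR \<theta> x \<tau> c j) \<and>
     (\<forall>c<nclus M. j \<notin> winnersR x \<tau> c)}"

definition participation :: "market \<Rightarrow> reports \<Rightarrow> trace \<Rightarrow> nat \<Rightarrow> bool" where
  "participation M \<theta> x \<tau> \<longleftrightarrow>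
     actE x \<tau> = {i. i < nexe M \<and> arrE \<theta> i \<le> \<tau> \<and> \<tau> < depE \<theta> i \<and>
                  (arrE \<theta> i = \<tau> \<or> 1 < \<tau> \<and> i \<in> carryE M \<theta> x (\<tau> - 1))} \<and>
     actR x \<tau> = {j. j < nreq M \<and> arrR \<theta> j \<le> \<tau> \<and> \<tau> < depR \<theta> j \<and>
                  (arrR \<theta> j = \<tau> \<or> 1 < \<tau> \<and> j \<in> carryR M \<theta> x (\<tau> - 1))}"

definition payments :: "market \<Rightarrow> reports \<Rightarrow> trace \<Rightarrow> nat \<Rightarrow> bool" where
  "payments M \<theta> x \<tau> \<longleftrightarrow>
     (\<forall>i\<in>actE x \<tau>. payE x \<tau> i =
        (if arrE \<theta> i = \<tau> then window_min (depE \<theta> i) (kappa M) \<tau> (slot_price_exe \<theta> x i)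
         else merge_prices min (payE x (\<tau> - 1) i) (slot_price_exe \<theta> x i \<tau>))) \<and>
     (\<forall>c<nclus M. \<forall>j\<in>actR x \<tau>. payR x \<tau> c j =
        (if arrR \<theta> j = \<tau> then window_max (depR \<theta> j) (kappa M) \<tau> (slot_price_req \<theta> x c)
         else merge_prices max (payR x (\<tau> - 1) c j) (slot_price_req \<theta> x c \<tau>)))"

definition allocation :: "market \<Rightarrow> reports \<Rightarrow> trace \<Rightarrow> nat \<Rightarrow> bool" where
  "allocation M \<theta> x \<tau> \<longleftrightarrow> (\<forall>c<nclus M.
     distinct (ordE x \<tau> c) \<and> set (ordE x \<tau> c) = retainedE \<theta> x \<tau> c \<and>
     sorted_wrt (\<lambda>i i'. the (payE x \<tau> i) \<le> the (payE x \<tau> i')) (ordE x \<tau> c) \<and>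
     distinct (ordR x \<tau> c) \<and> set (ordR x \<tau> c) = retainedR \<theta> x \<tau> c \<and>
     sorted_wrt (\<lambda>j j'. the (payR x \<tau> c j) \<ge> the (payR x \<tau> c j')) (ordR x \<tau> c))"

definition stem_run :: "market \<Rightarrow> reports \<Rightarrow> trace \<Rightarrow> bool" where
  "stem_run M \<theta> x \<longleftrightarrow> (\<forall>\<tau>\<in>{1..nslots M}.
     participation M \<theta> x \<tau> \<and>
     kmeans_outcome (nclus M) (loc M) (actE x \<tau>) (label x \<tau>) \<and>
     payments M \<theta> x \<tau> \<and>
     allocation M \<theta> x \<tau>)"


section \<open>Monetary transfers to the agents\<close>

definition transferE :: "trace \<Rightarrow> nat \<Rightarrow> nat \<Rightarrow> nat \<Rightarrow> real" where
  "transferE x \<tau> c i = (if i \<in> winnersE x \<tau> c then the (payE x \<tau> i) else 0)"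

definition transferR :: "trace \<Rightarrow> nat \<Rightarrow> nat \<Rightarrow> nat \<Rightarrow> real" where
  "transferR x \<tau> c j = (if j \<in> winnersR x \<tau> c then - the (payR x \<tau> c j) else 0)"

end

theory Submission
  imports Defs
begin

text \<open>
  The payments \<open>\<chi>\<^sup>e\<close> ascend and the payments \<open>\<chi>\<^sup>r\<close> descend along the allocation order, so for
  every matched index \<open>l \<le> \<I>\<close> we have
  \<open>\<chi>\<^sup>e\<^sub>l \<le> \<chi>\<^sup>e\<^sub>\<I> \<le> \<chi>\<^sup>r\<^sub>\<I> \<le> \<chi>\<^sup>r\<^sub>l\<close>: each matched pair runs no deficit.
\<close>

text \<open>\<open>sorted_wrt\<close> speaks only of positions \<open>i < j\<close>; reflexivity of
  the preorder supplies \<open>i = j\<close>.\<close>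

lemma sorted_wrt_mono_nth:
  fixes f :: "'a \<Rightarrow> 'b::preorder"
  assumes "sorted_wrt (\<lambda>a b. f a \<le> f b) xs" "i \<le> j" "j < length xs"
  shows "f (xs ! i) \<le> f (xs ! j)"
  using assms sorted_wrt_nth_less[OF assms(1), of i j] by (cases "i = j") auto

lemma sorted_wrt_antimono_nth:
  fixes f :: "'a \<Rightarrow> 'b::preorder"
  assumes "sorted_wrt (\<lambda>a b. f a \<ge> f b) xs" "i \<le> j" "j < length xs"
  shows "f (xs ! i) \<ge> f (xs ! j)"
  using assms sorted_wrt_nth_less[OF assms(1), of i j] by (cases "i = j") auto

text \<open>The maximum of a finite nonempty set belongs to it, so a nonzero \<open>trades\<close>
  is itself an index whose pair can trade. Smaller indices get no such guarantee here; it comes from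
  the sorting.\<close>

lemma trades_cases:
  obtains "trades x \<tau> c = 0"
  | "1 \<le> trades x \<tau> c" "trades x \<tau> c \<le> length (ordE x \<tau> c)" "trades x \<tau> c \<le> length (ordR x \<tau> c)"
    "the (payE x \<tau> (ordE x \<tau> c ! (trades x \<tau> c - 1)))
       \<le> the (payR x \<tau> c (ordR x \<tau> c ! (trades x \<tau> c - 1)))"
proof -
  let ?L = "{l. 1 \<le> l \<and> l \<le> length (ordE x \<tau> c) \<and> l \<le> length (ordR x \<tau> c) \<and>
     the (payR x \<tau> c (ordR x \<tau> c ! (l - 1))) - the (payE x \<tau> (ordE x \<tau> c ! (l - 1))) \<ge> 0}"
  have "finite ?L"
    by (rule finite_subset[of _ "{..length (ordE x \<tau> c)}"]) auto
  then have "trades x \<tau> c \<in> insert 0 ?L"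
    unfolding trades_def by (intro Max_in) auto
  then show ?thesis using that by auto
qed

lemma trades_le_length:
  "trades x \<tau> c \<le> length (ordE x \<tau> c)" "trades x \<tau> c \<le> length (ordR x \<tau> c)"
  by (rule trades_cases[of x \<tau> c]; simp)+

text \<open>Shifts the index from counting from 1 to list positions counting from 0, which removes
  the truncated \<open>l - 1\<close>.\<close>

lemma matching_eq_image:
  "matching x \<tau> c = (\<lambda>l. (ordE x \<tau> c ! l, ordR x \<tau> c ! l)) ` {..<trades x \<tau> c}"
proof -
  have "{1..trades x \<tau> c} = Suc ` {..<trades x \<tau> c}"
    by (simp add: lessThan_atLeast0 atLeastLessThanSuc_atLeastAtMost)
  then show ?thesis
    unfolding matching_def Setcompr_eq_image by (simp add: image_image)
qed

lemma winnersE_eq_image: "winnersE x \<tau> c = (!) (ordE x \<tau> c) ` {..<trades x \<tau> c}"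
  by (simp add: winnersE_def matching_eq_image image_image)

lemma winnersR_eq_image: "winnersR x \<tau> c = (!) (ordR x \<tau> c) ` {..<trades x \<tau> c}"
  by (simp add: winnersR_def matching_eq_image image_image)

lemma winnersE_subset: "winnersE x \<tau> c \<subseteq> set (ordE x \<tau> c)"
  using trades_le_length(1)[of x \<tau> c] by (auto simp: winnersE_eq_image)

lemma winnersR_subset: "winnersR x \<tau> c \<subseteq> set (ordR x \<tau> c)"
  using trades_le_length(2)[of x \<tau> c] by (auto simp: winnersR_eq_image)

text \<open>Distinctness makes list indexing injective, so no winner is counted twice. Executers and
  requesters thus get sums over one index range, which can be compared term by term.\<close>

lemma sum_winnersE:
  assumes "distinct (ordE x \<tau> c)"
  shows "(\<Sum>i\<in>winnersE x \<tau> c. g i) = (\<Sum>l<trades x \<tau> c. g (ordE x \<tau> c ! l))"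
  using assms trades_le_length(1)[of x \<tau> c]
  by (simp add: winnersE_eq_image sum.reindex inj_on_nth)

lemma sum_winnersR:
  assumes "distinct (ordR x \<tau> c)"
  shows "(\<Sum>j\<in>winnersR x \<tau> c. g j) = (\<Sum>l<trades x \<tau> c. g (ordR x \<tau> c ! l))"
  using assms trades_le_length(2)[of x \<tau> c]
  by (simp add: winnersR_eq_image sum.reindex inj_on_nth)

lemma matched_pair_no_deficit:
  assumes "sorted_wrt (\<lambda>i i'. the (payE x \<tau> i) \<le> the (payE x \<tau> i')) (ordE x \<tau> c)"
    and "sorted_wrt (\<lambda>j j'. the (payR x \<tau> c j) \<ge> the (payR x \<tau> c j')) (ordR x \<tau> c)"
    and "l < trades x \<tau> c"
  shows "the (payE x \<tau> (ordE x \<tau> c ! l)) \<le> the (payR x \<tau> c (ordR x \<tau> c ! l))"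
proof (cases rule: trades_cases[of x \<tau> c])
  case 2
  \<comment> \<open>List position of the last matched pair, the only one whose trade condition is
    known directly.\<close>
  let ?k = "trades x \<tau> c - 1"
  have "the (payE x \<tau> (ordE x \<tau> c ! l)) \<le> the (payE x \<tau> (ordE x \<tau> c ! ?k))"
    using sorted_wrt_mono_nth[OF assms(1), of l ?k] 2 assms(3) by simp
  also have "\<dots> \<le> the (payR x \<tau> c (ordR x \<tau> c ! ?k))"
    by (rule 2)
  also have "\<dots> \<le> the (payR x \<tau> c (ordR x \<tau> c ! l))"
    using sorted_wrt_antimono_nth[OF assms(2), of l ?k] 2 assms(3) by simp
  finally show ?thesis .
qed (use assms(3) in simp)

theorem lemma3:
  fixes M :: market and \<theta> :: reports and x :: trace and \<tau> c :: nat
  assumes "nclus M \<ge> 1"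
    and "admissible M \<theta>"
    and "stem_run M \<theta> x"
    and "\<tau> \<in> {1..nslots M}"
    and "c < nclus M"
  shows "(\<Sum>i<nexe M. transferE x \<tau> c i) + (\<Sum>j<nreq M. transferR x \<tau> c j) \<le> 0 \<and>
         (\<Sum>i\<in>winnersE x \<tau> c. the (payE x \<tau> i)) \<le> (\<Sum>j\<in>winnersR x \<tau> c. the (payR x \<tau> c j))"
proof -
  have part: "participation M \<theta> x \<tau>" and alloc: "allocation M \<theta> x \<tau>"
    using assms(3,4) by (auto simp: stem_run_def)
  have distinct: "distinct (ordE x \<tau> c)" "distinct (ordR x \<tau> c)"
    and retained: "set (ordE x \<tau> c) = retainedE \<theta> x \<tau> c" "set (ordR x \<tau> c) = retainedR \<theta> x \<tau> c"
    and sorted: "sorted_wrt (\<lambda>i i'. the (payE x \<tau> i) \<le> the (payE x \<tau> i')) (ordE x \<tau> c)"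
      "sorted_wrt (\<lambda>j j'. the (payR x \<tau> c j) \<ge> the (payR x \<tau> c j')) (ordR x \<tau> c)"
    using alloc assms(5) by (auto simp: allocation_def)
  have le: "(\<Sum>i\<in>winnersE x \<tau> c. the (payE x \<tau> i)) \<le> (\<Sum>j\<in>winnersR x \<tau> c. the (payR x \<tau> c j))"
    unfolding sum_winnersE[OF distinct(1)] sum_winnersR[OF distinct(2)]
    by (intro sum_mono matched_pair_no_deficit sorted) simp
  \<comment> \<open>Winners are retained, hence active, hence executers of the market. As transfers
    vanish off the winners, the sum over all executers collapses to the winners.\<close>
  have "winnersE x \<tau> c \<subseteq> {..<nexe M}"
    using winnersE_subset[of x \<tau> c] retained(1) part
    by (auto simp: retainedE_def cluster_def participation_def)
  then have "(\<Sum>i<nexe M. transferE x \<tau> c i) = (\<Sum>i\<in>winnersE x \<tau> c. the (payE x \<tau> i))"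
    by (simp add: transferE_def sum.If_cases Int_absorb1)
  \<comment> \<open>The same collapse for requesters, whose transfers carry a minus sign.\<close>
  moreover have "winnersR x \<tau> c \<subseteq> {..<nreq M}"
    using winnersR_subset[of x \<tau> c] retained(2) part
    by (auto simp: retainedR_def participation_def)
  then have "(\<Sum>j<nreq M. transferR x \<tau> c j) = - (\<Sum>j\<in>winnersR x \<tau> c. the (payR x \<tau> c j))"
    by (simp add: transferR_def sum.If_cases Int_absorb1 sum_negf)
  ultimately show ?thesis
    using le by simp
qed

end
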